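(* Let $n\ge 1$ and $M\ge 2$ be integers. Let $T\subset\mathbb{R}^n$ be the convex hull of $M$ points in $\mathbb{R}^n$ and assume that $T\subset B_2$. Then for all $s>0$, $$\ell(T\cap sB_2)\;\le\;\min\left(4\sqrt{\log_+\left(4eM\min(s^2,1)\right)}\,,\; s\sqrt{\min(n,M)}\right).$$
   Context: For $u\in\mathbb{R}^n$, $|u|_2$ is the Euclidean norm; $B_2=\{u\in\mathbb{R}^n:|u|_2\le 1\}$ and $sB_2=\{su: u\in B_2\}$. For $S\subset\mathbb{R}^n$, the Gaussian width is $\ell(S)=\mathbb{E}\sup_{u\in S}u^Tg$, where $g$ is a centered Gaussian random vector in $\mathbb{R}^n$ with covariance matrix $I_{n\times n}$. (If $T\cap sB_2$ is empty the inequality is regarded as trivially true.) $\log_+(a)=\max(1,\log a)$. *)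

theory Defs
  imports "HOL-Probability.Probability"
begin

definition std_gaussian_density :: "'a::euclidean_space \<Rightarrow> real" where
  "std_gaussian_density x = exp (- (norm x)\<^sup>2 / 2) / sqrt (2 * pi) ^ DIM('a)"

definition std_gaussian :: "'a::euclidean_space measure" where
  "std_gaussian = density lborel (\<lambda>x. ennreal (std_gaussian_density x))"

lemma std_gaussian_density_prod:
  "std_gaussian_density x = (\<Prod>b\<in>Basis. std_normal_density (x \<bullet> b))"
proof -
  have "exp (- (norm x)\<^sup>2 / 2) = (\<Prod>b\<in>Basis. exp (- (x \<bullet> b)\<^sup>2 / 2))"
    unfolding power2_norm_eq_inner
    by (subst euclidean_inner)
       (simp add: exp_sum[symmetric] sum_negf sum_divide_distrib power2_eq_square)
  then show ?thesis
    by (simp add: std_gaussian_density_def std_normal_density_def prod_dividef power_divide)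
qed

lemma std_gaussian_density_nonneg: "0 \<le> std_gaussian_density x"
  by (simp add: std_gaussian_density_def)

lemma borel_measurable_std_gaussian_density [measurable]:
  "std_gaussian_density \<in> borel_measurable borel"
  unfolding std_gaussian_density_def by measurable

lemma sets_std_gaussian [measurable_cong, simp]: "sets std_gaussian = sets borel"
  by (simp add: std_gaussian_def)

lemma space_std_gaussian [simp]: "space std_gaussian = UNIV"
  by (simp add: std_gaussian_def)

text \<open>Under the measure, the coordinates are independent standard normal variables.\<close>

lemma has_bochner_integral_std_gaussian_prod:
  fixes f :: "'a::euclidean_space \<Rightarrow> real \<Rightarrow> real"
  assumes [measurable]: "\<And>b. b \<in> Basis \<Longrightarrow> f b \<in> borel_measurable borel"
    and int: "\<And>b. b \<in> Basis \<Longrightarrow> integrable lborel (\<lambda>t. std_normal_density t * f b t)"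
  shows "has_bochner_integral std_gaussian (\<lambda>x. \<Prod>b\<in>Basis. f b (x \<bullet> b))
           (\<Prod>b\<in>Basis. \<integral>t. std_normal_density t * f b t \<partial>lborel)"
proof -
  interpret product_sigma_finite "\<lambda>b::'a. lborel :: real measure"
    by standard
  let ?P = "\<Pi>\<^sub>M b\<in>(Basis::'a set). (lborel :: real measure)"
  let ?h = "\<lambda>x::'a. \<Prod>b\<in>Basis. std_normal_density (x \<bullet> b) * f b (x \<bullet> b)"
  have [measurable]: "(\<lambda>g. \<Sum>b\<in>Basis. g b *\<^sub>R b) \<in> ?P \<rightarrow>\<^sub>M (borel :: 'a measure)"
    by measurable
  have hm [measurable]: "?h \<in> borel_measurable borel"
    by measurable
  have coord: "?h (\<Sum>b\<in>Basis. g b *\<^sub>R b) = (\<Prod>b\<in>Basis. std_normal_density (g b) * f b (g b))" for g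
    by (intro prod.cong) (simp_all add: inner_sum_left inner_Basis if_distrib cong: if_cong)
  have "has_bochner_integral ?P (\<lambda>g. \<Prod>b\<in>Basis. std_normal_density (g b) * f b (g b))
          (\<Prod>b\<in>Basis. \<integral>t. std_normal_density t * f b t \<partial>lborel)"
    unfolding has_bochner_integral_iff
    by (intro conjI product_integrable_prod product_integral_prod) (simp_all add: int)
  then have "has_bochner_integral lborel ?h
          (\<Prod>b\<in>Basis. \<integral>t. std_normal_density t * f b t \<partial>lborel)"
    by (subst lborel_eq)
       (simp add: has_bochner_integral_iff integrable_distr_eq integral_distr coord del: prod.distrib)
  then have "has_bochner_integral lborel
          (\<lambda>x. std_gaussian_density x *\<^sub>R (\<Prod>b\<in>Basis. f b (x \<bullet> b)))
          (\<Prod>b\<in>Basis. \<integral>t. std_normal_density t * f b t \<partial>lborel)"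
    by (simp add: std_gaussian_density_prod prod.distrib)
  then show ?thesis
    unfolding std_gaussian_def
    by (intro has_bochner_integral_density) (auto simp: std_gaussian_density_nonneg)
qed

lemma prob_space_std_gaussian: "prob_space (std_gaussian :: 'a::euclidean_space measure)"
proof -
  have "has_bochner_integral std_gaussian (\<lambda>x::'a. \<Prod>b\<in>(Basis::'a set). 1) (1::real)"
    using has_bochner_integral_std_gaussian_prod[of "\<lambda>(b::'a) t. 1"]
      std_normal_moment_even[of 0]
    by (simp add: has_bochner_integral_iff)
  then have *: "has_bochner_integral std_gaussian (\<lambda>x::'a. 1::real) 1"
    by simp
  then have "(\<integral>\<^sup>+x. ennreal 1 \<partial>(std_gaussian :: 'a measure)) = ennreal 1"
    by (subst nn_integral_eq_integral) (simp_all add: has_bochner_integral_iff)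
  then show ?thesis
    by (intro prob_spaceI) simp
qed

lemma std_gaussian_mean:
  fixes b :: "'a::euclidean_space"
  assumes b: "b \<in> Basis"
  shows "has_bochner_integral std_gaussian (\<lambda>x. x \<bullet> b) 0"
proof -
  let ?f = "\<lambda>(c::'a) t::real. if c = b then t else 1"
  have m: "has_bochner_integral lborel (\<lambda>t. std_normal_density t * ?f c t)
      (if c = b then 0 else 1)" for c
    using std_normal_moment_odd[of 0] std_normal_moment_even[of 0] by simp
  have "has_bochner_integral std_gaussian (\<lambda>x. \<Prod>c\<in>Basis. ?f c (x \<bullet> c))
          (\<Prod>c\<in>Basis. \<integral>t. std_normal_density t * ?f c t \<partial>lborel)"
    by (rule has_bochner_integral_std_gaussian_prod)
       (use m in \<open>simp_all add: has_bochner_integral_iff\<close>)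
  moreover have "(\<Prod>c\<in>Basis. ?f c (x \<bullet> c)) = x \<bullet> b" for x
    using b by (simp add: prod.delta)
  moreover have "(\<Prod>c\<in>Basis. \<integral>t. std_normal_density t * ?f c t \<partial>lborel) = 0"
    using m[THEN has_bochner_integral_integral_eq] b by (auto intro!: prod_zero bexI[of _ b])
  ultimately show ?thesis by simp
qed

lemma std_gaussian_covariance:
  fixes b c :: "'a::euclidean_space"
  assumes b: "b \<in> Basis" and c: "c \<in> Basis"
  shows "has_bochner_integral std_gaussian (\<lambda>x. (x \<bullet> b) * (x \<bullet> c)) (if b = c then 1 else 0)"
proof -
  let ?f = "\<lambda>(d::'a) t::real. (if d = b then t else 1) * (if d = c then t else 1)"
  have m: "has_bochner_integral lborel (\<lambda>t. std_normal_density t * ?f d t)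
      (if (d = b) = (d = c) then 1 else 0)" for d
    using std_normal_moment_odd[of 0] std_normal_moment_even[of 0] std_normal_moment_even[of 1]
    by (cases "d = b"; cases "d = c") (simp_all add: power2_eq_square)
  have "has_bochner_integral std_gaussian (\<lambda>x. \<Prod>d\<in>Basis. ?f d (x \<bullet> d))
          (\<Prod>d\<in>Basis. \<integral>t. std_normal_density t * ?f d t \<partial>lborel)"
    by (rule has_bochner_integral_std_gaussian_prod)
       (use m in \<open>simp_all add: has_bochner_integral_iff\<close>)
  moreover have "(\<Prod>d\<in>Basis. ?f d (x \<bullet> d)) = (x \<bullet> b) * (x \<bullet> c)" for x
    using b c by (simp add: prod.distrib prod.delta)
  moreover have "(\<Prod>d\<in>Basis. \<integral>t. std_normal_density t * ?f d t \<partial>lborel) = (if b = c then 1 else 0)"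
    using m[THEN has_bochner_integral_integral_eq] b
    by (auto intro!: prod.neutral prod_zero bexI[of _ b])
  ultimately show ?thesis by simp
qed

text \<open>
  The supremum is the one of \<^typ>\<open>real\<close>, so this is the Gaussian width only for nonempty sets on
  which the supremum is finite; for nonempty bounded sets it is integrable, as shown below.
\<close>

definition gaussian_width :: "'a::euclidean_space set \<Rightarrow> real" where
  "gaussian_width S = (\<integral>g. (SUP u\<in>S. u \<bullet> g) \<partial>std_gaussian)"

lemma integrable_gaussian_width:
  fixes S :: "'a::euclidean_space set"
  assumes ne: "S \<noteq> {}" and bd: "bounded S"
  shows "integrable std_gaussian (\<lambda>g. SUP u\<in>S. u \<bullet> g)"
proof -
  interpret prob_space "std_gaussian :: 'a measure"
    by (rule prob_space_std_gaussian)
  obtain B where B: "\<And>u. u \<in> S \<Longrightarrow> norm u \<le> B" and "B > 0"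
    using bd unfolding bounded_pos by blast
  have le: "u \<bullet> g \<le> B * norm g" if "u \<in> S" for u g
    by (meson B that mult_right_mono norm_cauchy_schwarz norm_ge_zero order_trans)
  have ge: "- (B * norm g) \<le> u \<bullet> g" if "u \<in> S" for u g
    using le[OF that, of "- g"] by simp
  have bdd: "bdd_above ((\<lambda>u. u \<bullet> g) ` S)" for g
    using le by (auto intro!: bdd_aboveI[of _ "B * norm g"])
  have diff: "(SUP u\<in>S. u \<bullet> g) \<le> (SUP u\<in>S. u \<bullet> h) + B * norm (g - h)" for g h
  proof (rule cSUP_least[OF ne])
    fix u assume u: "u \<in> S"
    have "u \<bullet> g = u \<bullet> h + u \<bullet> (g - h)" by (simp add: inner_diff_right)
    then show "u \<bullet> g \<le> (SUP u\<in>S. u \<bullet> h) + B * norm (g - h)"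
      using cSUP_upper[OF u bdd[of h]] le[OF u, of "g - h"] by linarith
  qed
  have "B-lipschitz_on UNIV (\<lambda>g. SUP u\<in>S. u \<bullet> g)"
  proof (rule lipschitz_onI)
    fix g h :: 'a
    show "dist (SUP u\<in>S. u \<bullet> g) (SUP u\<in>S. u \<bullet> h) \<le> B * dist g h"
      using diff[of g h] diff[of h g] by (simp add: dist_norm norm_minus_commute abs_le_iff)
  qed (use \<open>B > 0\<close> in simp)
  then have "continuous_on UNIV (\<lambda>g. SUP u\<in>S. u \<bullet> g)"
    by (rule lipschitz_on_continuous_on)
  then have meas [measurable]: "(\<lambda>g. SUP u\<in>S. u \<bullet> g) \<in> borel_measurable borel"
    by (rule borel_measurable_continuous_onI)
  have "integrable (std_gaussian :: 'a measure) (\<lambda>g. B * (\<Sum>b\<in>Basis. \<bar>g \<bullet> b\<bar>))"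
    using std_gaussian_mean[where 'a='a]
    by (intro integrable_mult_right Bochner_Integration.integrable_sum integrable_abs)
       (simp add: has_bochner_integral_iff)
  then show ?thesis
  proof (rule Bochner_Integration.integrable_bound)
    show "AE g in std_gaussian. norm (SUP u\<in>S. u \<bullet> g) \<le> norm (B * (\<Sum>b\<in>Basis. \<bar>g \<bullet> b\<bar>))"
    proof (rule AE_I2)
      fix g :: 'a
      obtain u where u: "u \<in> S" using ne by blast
      have "(SUP u\<in>S. u \<bullet> g) \<le> B * norm g"
        using le by (intro cSUP_least[OF ne])
      moreover have "- (B * norm g) \<le> (SUP u\<in>S. u \<bullet> g)"
        using ge[OF u, of g] cSUP_upper[OF u bdd[of g]] by linarith
      moreover have "B * norm g \<le> B * (\<Sum>b\<in>Basis. \<bar>g \<bullet> b\<bar>)"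
        using norm_le_l1[of g] \<open>B > 0\<close> by simp
      ultimately show "norm (SUP u\<in>S. u \<bullet> g) \<le> norm (B * (\<Sum>b\<in>Basis. \<bar>g \<bullet> b\<bar>))"
        by simp
    qed
  qed measurable
qed

definition log_plus :: "real \<Rightarrow> real" where
  "log_plus a = max 1 (ln a)"

end

theory Submission
  imports Defs
begin

text \<open>
  The bound \<open>s * sqrt (min n M)\<close> only uses that the set lies in the ball of radius \<open>s\<close> of a subspace
  of dimension at most \<open>min n M\<close>: the supremum of \<open>u \<bullet> g\<close> is at most \<open>s\<close> times the norm of the
  projection of \<open>g\<close> to that subspace, and the squared norm of the projection has the dimension as
  its expectation (\<open>gaussian_width_le_sqrt_dim\<close>).

  For the logarithmic bound let \<open>r = min s 1\<close>. By Maurey's empirical method, a point of the hull is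
  approximated by averages of \<open>m\<close> vertices, with squared error of order \<open>1 / m\<close>; there are
  \<open>(M + m - 1) choose m\<close> multisets of \<open>m\<close> out of \<open>M\<close> vertices, and \<open>m\<close> of order \<open>1 / r\<^sup>2\<close> is
  sufficiently accurate. The average of a random sample has squared norm of order \<open>r\<^sup>2\<close> in
  expectation only, and individual averages may be much longer than that. This is handled by a
  Lagrangian: for \<open>norm u \<le> r\<close>,
  \<open>u \<bullet> g \<le> lam * r\<^sup>2 + (u \<bullet> g - lam * (norm u)\<^sup>2)\<close>, and Maurey's argument is applied to the penalized
  functional in the bracket, where it loses only \<open>lam / m\<close> (\<open>maurey_penalized\<close>). The resulting
  finite maximum of penalized Gaussian variables is controlled by exponential moments: the one at
  \<open>2 * lam\<close> is exactly \<open>1\<close> for each average, long or short. So for all \<open>lam > 0\<close> the width is at most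
  \<open>lam * (r\<^sup>2 + 1 / m)\<close> plus the logarithm of the number of averages divided by \<open>2 * lam\<close>
  (\<open>gaussian_width_convex_hull_le\<close>). With \<open>m = \<lfloor>1 / r\<^sup>2\<rfloor>\<close> and \<open>lam\<close> of the right order this is at
  most \<open>5 / 2 * sqrt (ln (4 * e * M * r\<^sup>2))\<close>, provided that \<open>m \<le> M\<close>, which is ensured by
  \<open>M * r\<^sup>2 \<ge> 1\<close>. In the remaining range \<open>M * r\<^sup>2 < 1\<close> the dimension bound gives a width below \<open>1\<close>.
\<close>

section \<open>Gaussian integrals and upper bounds on the width\<close>

lemma has_bochner_integral_std_gaussian_const:
  fixes c :: real
  shows "has_bochner_integral (std_gaussian :: 'a::euclidean_space measure) (\<lambda>_. c) c"
proof -
  interpret prob_space "std_gaussian :: 'a measure"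
    by (rule prob_space_std_gaussian)
  show ?thesis
    using prob_space by (simp add: has_bochner_integral_iff)
qed

lemma has_bochner_integral_std_gaussian_exp:
  fixes v :: "'a::euclidean_space"
  shows "has_bochner_integral std_gaussian (\<lambda>g. exp (v \<bullet> g)) (exp ((norm v)\<^sup>2 / 2))"
proof -
  have shift: "std_normal_density t * exp (t * a) = exp (a\<^sup>2 / 2) * normal_density a 1 t" for t a :: real
    by (simp add: normal_density_def exp_add[symmetric] exp_diff[symmetric] power2_eq_square field_simps)
  have "has_bochner_integral std_gaussian (\<lambda>g. \<Prod>b\<in>Basis. exp ((g \<bullet> b) * (v \<bullet> b)))
          (\<Prod>b\<in>Basis. \<integral>t. std_normal_density t * exp (t * (v \<bullet> b)) \<partial>lborel)"
    by (rule has_bochner_integral_std_gaussian_prod) (simp_all add: shift)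
  moreover have "(\<Prod>b\<in>Basis. exp ((g \<bullet> b) * (v \<bullet> b))) = exp (v \<bullet> g)" for g
    by (subst euclidean_inner) (simp add: exp_sum mult.commute)
  moreover have "(\<Prod>b\<in>Basis. \<integral>t. std_normal_density t * exp (t * (v \<bullet> b)) \<partial>lborel)
      = exp ((norm v)\<^sup>2 / 2)"
    unfolding power2_norm_eq_inner
    by (subst euclidean_inner) (simp add: shift exp_sum sum_divide_distrib power2_eq_square)
  ultimately show ?thesis by simp
qed

lemma has_bochner_integral_std_gaussian_inner_square:
  fixes v :: "'a::euclidean_space"
  shows "has_bochner_integral std_gaussian (\<lambda>g. (v \<bullet> g)\<^sup>2) ((norm v)\<^sup>2)"
proof -
  have "has_bochner_integral std_gaussian
      (\<lambda>g. \<Sum>b\<in>Basis. \<Sum>c\<in>Basis. (v \<bullet> b) * (v \<bullet> c) * ((g \<bullet> b) * (g \<bullet> c)))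
      (\<Sum>b\<in>Basis. \<Sum>c\<in>Basis. (v \<bullet> b) * (v \<bullet> c) * (if b = c then 1 else 0))"
    by (intro has_bochner_integral_sum has_bochner_integral_mult_right std_gaussian_covariance)
  moreover have "(\<Sum>b\<in>Basis. \<Sum>c\<in>Basis. (v \<bullet> b) * (v \<bullet> c) * ((g \<bullet> b) * (g \<bullet> c))) = (v \<bullet> g)\<^sup>2" for g
    unfolding power2_eq_square
    by (subst (5 6) euclidean_inner) (simp add: sum_product algebra_simps)
  moreover have "(\<Sum>b\<in>Basis. \<Sum>c\<in>Basis. (v \<bullet> b) * (v \<bullet> c) * (if b = c then 1 else 0)) = (norm v)\<^sup>2"
    unfolding power2_norm_eq_inner
    by (subst (3) euclidean_inner) (simp add: if_distrib cong: if_cong)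
  ultimately show ?thesis by simp
qed

text \<open>
  Both bounds apply Jensen's inequality (to the square root, to the logarithm) in its pointwise
  form: the concave function is replaced by a tangent, which yields a majorant \<open>F\<close> of \<open>u \<bullet> g\<close>,
  uniform in \<open>u\<close>, that is affine in quantities of known expectation.
\<close>

lemma gaussian_width_le_expectation:
  fixes S :: "'a::euclidean_space set"
  assumes "S \<noteq> {}" "bounded S"
    and "has_bochner_integral std_gaussian F C"
    and "\<And>u g. u \<in> S \<Longrightarrow> u \<bullet> g \<le> F g"
  shows "gaussian_width S \<le> C"
proof -
  have "gaussian_width S \<le> (\<integral>g. F g \<partial>std_gaussian)"
    unfolding gaussian_width_def
    using assms integrable_gaussian_width[of S]
    by (intro integral_mono cSUP_least) (auto simp: has_bochner_integral_iff)
  also have "\<dots> = C"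
    using assms(3) by (rule has_bochner_integral_integral_eq)
  finally show ?thesis .
qed

section \<open>The dimension bound\<close>

text \<open>
  For \<open>u \<in> S\<close> only the projection \<open>q\<close> of \<open>g\<close> to \<open>span S\<close> matters, so \<open>u \<bullet> g \<le> r * norm q\<close>, and
  \<open>(norm q)\<^sup>2\<close> has expectation \<open>dim S\<close>.
\<close>

lemma gaussian_width_le_sqrt_dim:
  fixes S :: "'a::euclidean_space set"
  assumes ne: "S \<noteq> {}" and r: "\<And>u. u \<in> S \<Longrightarrow> norm u \<le> r"
  shows "gaussian_width S \<le> r * sqrt (dim S)"
proof -
  obtain B where B: "pairwise orthogonal B" "\<And>b. b \<in> B \<Longrightarrow> norm b = 1" "independent B"
      "card B = dim S" "span B = span S"
    using orthonormal_basis_subspace[OF subspace_span[of S]] by (metis dim_span)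
  have fin: "finite B"
    using B(3) by (rule independent_imp_finite)
  define Y where "Y g = (\<Sum>b\<in>B. (b \<bullet> g)\<^sup>2)" for g
  \<comment> \<open>the slope \<open>1 / (2 * c)\<close> belongs to the tangent of the square root at \<open>dim S\<close>\<close>
  define c where "c = sqrt (dim S)"
  have c2: "c\<^sup>2 = dim S" and c0: "c \<ge> 0"
    by (simp_all add: c_def)
  have "has_bochner_integral std_gaussian Y (\<Sum>b\<in>B. (norm b)\<^sup>2)"
    unfolding Y_def
    by (intro has_bochner_integral_sum has_bochner_integral_std_gaussian_inner_square)
  then have Y: "has_bochner_integral std_gaussian Y (c\<^sup>2)"
    using B(2,4) c2 by simp
  have "r \<ge> 0"
    using ne r norm_ge_zero order_trans by blast
  show ?thesis
  proof (rule gaussian_width_le_expectation[OF ne])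
    show "bounded S"
      using r by (auto simp: bounded_iff)
    have "has_bochner_integral std_gaussian (\<lambda>g. r * ((Y g / c + c) / 2)) (r * ((c\<^sup>2 / c + c) / 2))"
      by (intro has_bochner_integral_mult_right has_bochner_integral_divide_zero
          has_bochner_integral_add Y has_bochner_integral_std_gaussian_const)
    moreover have "(c\<^sup>2 / c + c) / 2 = sqrt (dim S)"
      unfolding c_def[symmetric] by (cases "c = 0") (simp_all add: power2_eq_square)
    ultimately show "has_bochner_integral std_gaussian (\<lambda>g. r * ((Y g / c + c) / 2)) (r * sqrt (dim S))"
      by simp
  next
    fix u g :: 'a
    assume u: "u \<in> S"
    define q where "q = (\<Sum>b\<in>B. (b \<bullet> g) *\<^sub>R b)"
    have "u = (\<Sum>b\<in>B. (u \<bullet> b) *\<^sub>R b)"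
      using orthonormal_basis_expand[OF B(1,2) _ fin, of u] B(5) u span_base by metis
    then have "u \<bullet> g = (\<Sum>b\<in>B. (u \<bullet> b) *\<^sub>R b) \<bullet> g"
      by metis
    also have "\<dots> = u \<bullet> q"
      by (simp add: q_def inner_sum_left inner_sum_right mult.commute)
    finally have "u \<bullet> g = u \<bullet> q" .
    also have "\<dots> \<le> r * norm q"
      using norm_cauchy_schwarz[of u q] mult_right_mono[OF r[OF u], of "norm q"] by simp
    \<comment> \<open>for \<open>c = 0\<close> the right-hand side is \<open>0\<close>, because division by zero gives zero\<close>
    also have "norm q \<le> (Y g / c + c) / 2"
    proof (cases "c = 0")
      case True
      then have "B = {}" using B(4) c2 fin by (simp del: dim_eq_0)
      then show ?thesis using True by (simp add: q_def)
    next
      case False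
      have "(norm q)\<^sup>2 = (\<Sum>b\<in>B. (norm ((b \<bullet> g) *\<^sub>R b))\<^sup>2)"
        unfolding q_def
        by (rule norm_sum_Pythagorean[OF fin]) (use B(1) in \<open>auto simp: pairwise_def orthogonal_def\<close>)
      also have "\<dots> = Y g"
        using B(2) by (simp add: Y_def)
      finally have "Y g = (norm q)\<^sup>2" by simp
      moreover have "0 \<le> (norm q - c)\<^sup>2" by simp
      ultimately show ?thesis
        using False c0 by (simp add: field_simps power2_eq_square)
    qed
    finally show "u \<bullet> g \<le> r * ((Y g / c + c) / 2)"
      using \<open>r \<ge> 0\<close> by (simp add: mult_left_mono)
  qed
qed

section \<open>Empirical approximation and the penalized maximum\<close>

text \<open>
  A greedy form of Maurey's argument. The random sample of \<open>k\<close> vertices is replaced by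
  a deterministic exchange: one copy of \<open>c *\<^sub>R u\<close> at a time is traded for \<open>c *\<^sub>R p\<close> with a vertex
  \<open>p\<close>. Apart from the term \<open>- lam * c\<^sup>2 * (norm p)\<^sup>2\<close>, the objective \<open>x \<bullet> g - lam * (norm x)\<^sup>2\<close> is
  affine in the exchanged vector, so some vertex does at least as well as the point \<open>u\<close> of the hull,
  and each exchange costs at most \<open>lam * c\<^sup>2\<close>. The offset \<open>w\<close> collects the copies of \<open>u\<close> not yet
  exchanged; with \<open>c = 1 / k\<close> the total cost is \<open>lam / k\<close>.
\<close>

lemma maurey_penalized:
  fixes P :: "'a::euclidean_space set"
  assumes u: "u \<in> convex hull P" and P: "\<And>p. p \<in> P \<Longrightarrow> norm p \<le> 1" and lam: "0 \<le> lam"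
  shows "\<exists>X. set_mset X \<subseteq> P \<and> size X = k \<and>
      (w + (c * real k) *\<^sub>R u) \<bullet> g - lam * (norm (w + (c * real k) *\<^sub>R u))\<^sup>2
      \<le> (w + c *\<^sub>R \<Sum>\<^sub># X) \<bullet> g - lam * (norm (w + c *\<^sub>R \<Sum>\<^sub># X))\<^sup>2 + real k * lam * c\<^sup>2"
proof (induction k arbitrary: w)
  case 0
  show ?case by (rule exI[of _ "{#}"]) simp
next
  case (Suc k)
  define h where "h x = x \<bullet> g - lam * (norm x)\<^sup>2" for x
  obtain X where X: "set_mset X \<subseteq> P" "size X = k"
      "h (w + c *\<^sub>R u + (c * real k) *\<^sub>R u)
        \<le> h (w + c *\<^sub>R u + c *\<^sub>R \<Sum>\<^sub># X) + real k * lam * c\<^sup>2"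
    using Suc[of "w + c *\<^sub>R u"] unfolding h_def by blast
  define w' where "w' = w + c *\<^sub>R \<Sum>\<^sub># X"
  \<comment> \<open>the linear part of \<open>\<lambda>x. h (w' + c *\<^sub>R x)\<close>\<close>
  define a where "a = c *\<^sub>R g - (2 * lam * c) *\<^sub>R w'"
  have "\<exists>p\<in>P. a \<bullet> u \<le> a \<bullet> p"
  proof (rule ccontr)
    assume "\<not> ?thesis"
    then have "P \<subseteq> {x. a \<bullet> x < a \<bullet> u}" by auto
    then have "convex hull P \<subseteq> {x. a \<bullet> x < a \<bullet> u}"
      by (rule hull_minimal) (rule convex_halfspace_lt)
    then show False using u by auto
  qed
  then obtain p where p: "p \<in> P" "a \<bullet> u \<le> a \<bullet> p" by blast
  have expand: "h (w' + c *\<^sub>R x) = h w' + a \<bullet> x - lam * c\<^sup>2 * (norm x)\<^sup>2" for x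
    unfolding h_def a_def power2_norm_eq_inner
    by (simp add: algebra_simps inner_commute power2_eq_square)
  have "(norm p)\<^sup>2 \<le> 1"
    using P[OF p(1)] by (simp add: power_le_one)
  then have "lam * c\<^sup>2 * (norm p)\<^sup>2 \<le> lam * c\<^sup>2"
    using lam by (simp add: mult_left_le)
  moreover have "0 \<le> lam * c\<^sup>2 * (norm u)\<^sup>2"
    using lam by simp
  ultimately have "h (w' + c *\<^sub>R u) \<le> h (w' + c *\<^sub>R p) + lam * c\<^sup>2"
    using p(2) unfolding expand by linarith
  moreover have "w' + c *\<^sub>R u = w + c *\<^sub>R u + c *\<^sub>R \<Sum>\<^sub># X"
      "w' + c *\<^sub>R p = w + c *\<^sub>R \<Sum>\<^sub># (add_mset p X)"
      "w + (c * real (Suc k)) *\<^sub>R u = w + c *\<^sub>R u + (c * real k) *\<^sub>R u"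
    by (simp_all add: w'_def algebra_simps)
  ultimately have "h (w + (c * real (Suc k)) *\<^sub>R u)
      \<le> h (w + c *\<^sub>R \<Sum>\<^sub># (add_mset p X)) + real (Suc k) * lam * c\<^sup>2"
    using X(3) by (simp add: algebra_simps)
  then show ?case
    unfolding h_def using X(1,2) p(1) by (intro exI[of _ "add_mset p X"]) auto
qed

text \<open>
  On \<open>S\<close> the penalty \<open>lam * (norm u)\<^sup>2\<close> is at most \<open>lam * r\<^sup>2\<close>, so inserting it costs little, and the
  penalized supremum over the hull is within \<open>lam / m\<close> of a maximum over the finite set \<open>V\<close> of
  averages of \<open>m\<close> vertices. The averages need not have norm of order \<open>r\<close>, so a union bound
  over \<open>V\<close> alone would lose the dependence on \<open>r\<close>. The penalty
  repairs this: at inverse temperature \<open>2 * lam\<close>, the exponential moment of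
  \<open>v \<bullet> g - lam * (norm v)\<^sup>2\<close> is exactly \<open>1\<close>, whatever the size of \<open>v\<close>. Hence the maximum over
  \<open>V\<close> has expectation at most \<open>ln (card V) / (2 * lam)\<close>.
\<close>

lemma gaussian_width_convex_hull_le:
  fixes P S :: "'a::euclidean_space set"
  assumes finP: "finite P" and P: "\<And>p. p \<in> P \<Longrightarrow> norm p \<le> 1"
    and ne: "S \<noteq> {}" and S: "S \<subseteq> convex hull P" and r: "\<And>u. u \<in> S \<Longrightarrow> norm u \<le> r"
    and m: "0 < m" and lam: "0 < lam"
  shows "gaussian_width S
    \<le> lam * (r\<^sup>2 + 1 / real m) + ln (real ((card P + m - 1) choose m)) / (2 * lam)"
proof -
  define V where "V = (\<lambda>X. (1 / real m) *\<^sub>R \<Sum>\<^sub># X) ` multisets_of_size P m"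
  define N where "N = real ((card P + m - 1) choose m)"
  define E where "E v g = exp (2 * lam * (v \<bullet> g) - 2 * lam\<^sup>2 * (norm v)\<^sup>2)" for v g :: 'a
  have "P \<noteq> {}" using ne S by auto
  then have "card P > 0" using finP by (simp add: card_gt_0_iff)
  then have N: "N > 0"
    unfolding N_def of_nat_0_less_iff by (intro zero_less_binomial) simp
  have finV: "finite V"
    unfolding V_def using finP by (intro finite_imageI finite_multisets_of_size)
  have cardV: "card V \<le> N"
    unfolding V_def N_def card_multisets_of_size[OF finP, symmetric] of_nat_le_iff
    by (intro card_image_le finite_multisets_of_size finP)
  have E: "has_bochner_integral std_gaussian (E v) 1" for v
  proof -
    have "has_bochner_integral std_gaussian
        (\<lambda>g. exp (- 2 * lam\<^sup>2 * (norm v)\<^sup>2) * exp (((2 * lam) *\<^sub>R v) \<bullet> g))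
        (exp (- 2 * lam\<^sup>2 * (norm v)\<^sup>2) * exp ((norm ((2 * lam) *\<^sub>R v))\<^sup>2 / 2))"
      by (intro has_bochner_integral_mult_right has_bochner_integral_std_gaussian_exp)
    then show ?thesis
      by (simp add: E_def[abs_def] exp_add[symmetric] power_mult_distrib)
  qed
  define F where "F g = lam * (r\<^sup>2 + 1 / real m) + ((ln N - 1) + (\<Sum>v\<in>V. E v g) / N) / (2 * lam)" for g
  have "has_bochner_integral std_gaussian F
      (lam * (r\<^sup>2 + 1 / real m) + ((ln N - 1) + (\<Sum>v\<in>V. 1) / N) / (2 * lam))"
    unfolding F_def
    by (intro has_bochner_integral_add has_bochner_integral_divide_zero has_bochner_integral_sum E
        has_bochner_integral_std_gaussian_const)
  then have "gaussian_width S \<le> lam * (r\<^sup>2 + 1 / real m) + ((ln N - 1) + (\<Sum>v\<in>V. 1) / N) / (2 * lam)"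
  proof (rule gaussian_width_le_expectation[rotated 2])
    show "S \<noteq> {}" by fact
    show "bounded S" using r by (auto simp: bounded_iff)
    fix u g
    assume u: "u \<in> S"
    obtain X where X: "X \<in> multisets_of_size P m"
      "u \<bullet> g - lam * (norm u)\<^sup>2 \<le> ((1 / real m) *\<^sub>R \<Sum>\<^sub># X) \<bullet> g
          - lam * (norm ((1 / real m) *\<^sub>R \<Sum>\<^sub># X))\<^sup>2 + real m * lam * (1 / real m)\<^sup>2"
      using maurey_penalized[where w = 0 and u = u and P = P and k = m and c = "1 / real m"
          and lam = lam and g = g] u S P lam m
      by (auto simp: multisets_of_size_def)
    define v where "v = (1 / real m) *\<^sub>R \<Sum>\<^sub># X"
    have v: "v \<in> V" using X(1) by (auto simp: V_def v_def)
    have "(norm u)\<^sup>2 \<le> r\<^sup>2" using r[OF u] by (simp add: power_mono)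
    then have "lam * (norm u)\<^sup>2 \<le> lam * r\<^sup>2" using lam by simp
    moreover have "real m * lam * (1 / real m)\<^sup>2 = lam / real m"
      using m by (simp add: power2_eq_square field_simps)
    ultimately have 1: "u \<bullet> g \<le> lam * (r\<^sup>2 + 1 / real m) + (v \<bullet> g - lam * (norm v)\<^sup>2)"
      using X(2) unfolding v_def[symmetric] by (simp add: algebra_simps)
    define y where "y = 2 * lam * (v \<bullet> g) - 2 * lam\<^sup>2 * (norm v)\<^sup>2"
    \<comment> \<open>the tangent of \<open>ln\<close> at \<open>N\<close> bounds \<open>y\<close> by an affine function of \<open>exp y\<close>\<close>
    have "y = ln N + (y - ln N)" by simp
    also have "\<dots> \<le> ln N + (exp (y - ln N) - 1)"
      using exp_ge_add_one_self[of "y - ln N"] by linarith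
    also have "\<dots> = ln N - 1 + E v g / N"
      using N by (simp add: exp_diff E_def y_def)
    also have "\<dots> \<le> ln N - 1 + (\<Sum>v\<in>V. E v g) / N"
      using N by (intro add_left_mono divide_right_mono member_le_sum v finV) (auto simp: E_def)
    finally have "y / (2 * lam) \<le> (ln N - 1 + (\<Sum>v\<in>V. E v g) / N) / (2 * lam)"
      using lam by (intro divide_right_mono) auto
    moreover have "y / (2 * lam) = v \<bullet> g - lam * (norm v)\<^sup>2"
      using lam by (simp add: y_def field_simps power2_eq_square)
    ultimately show "u \<bullet> g \<le> F g"
      using 1 by (simp add: F_def)
  qed
  also have "\<dots> \<le> lam * (r\<^sup>2 + 1 / real m) + ln N / (2 * lam)"
    using N cardV lam by (intro add_left_mono divide_right_mono) auto
  finally show ?thesis unfolding N_def .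
qed

section \<open>Choice of the sample size and of the penalty\<close>

text \<open>
  This is \<open>n choose m \<le> n ^ m / fact m\<close> combined with \<open>fact m \<ge> (m / e) ^ m\<close>; the latter holds
  because \<open>m ^ m / fact m\<close> is one term of the series of \<open>exp m\<close>.
\<close>

lemma ln_binomial_le:
  assumes "0 < m" "0 < n" "0 < n choose m"
  shows "ln (real (n choose m)) \<le> real m * ln (exp 1 * real n / real m)"
proof -
  have "real m ^ m / fact m \<le> exp (real m)"
  proof -
    have "(\<Sum>k\<in>{m}. real m ^ k /\<^sub>R fact k) \<le> (\<Sum>k. real m ^ k /\<^sub>R fact k)"
      by (intro sum_le_suminf sums_summable[OF exp_converges]) auto
    then show ?thesis
      by (simp add: exp_def divide_inverse mult.commute)
  qed
  then have fact: "real m ^ m \<le> exp (real m) * fact m"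
    by (simp add: field_simps)
  have "real (n choose m) * real m ^ m \<le> real (n choose m) * (exp (real m) * fact m)"
    using fact by (intro mult_left_mono) auto
  also have "\<dots> = exp (real m) * real ((n choose m) * fact m)"
    by (simp add: algebra_simps)
  also have "\<dots> \<le> exp (real m) * real (n ^ m)"
    using binomial_fact_pow[of n m] by (intro mult_left_mono) (simp_all only: of_nat_le_iff exp_ge_zero)
  finally have "real (n choose m) \<le> (exp 1 * real n / real m) ^ m"
    using assms(1) by (simp add: power_divide power_mult_distrib exp_of_nat_mult[symmetric] field_simps)
  then have "ln (real (n choose m)) \<le> ln ((exp 1 * real n / real m) ^ m)"
    using assms by (subst ln_le_cancel_iff) auto
  also have "\<dots> = real m * ln (exp 1 * real n / real m)"
    using assms by (simp add: ln_realpow)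
  finally show ?thesis .
qed

text \<open>
  The error \<open>1 / m\<close> of the approximation should be of order \<open>r\<^sup>2\<close>, hence \<open>m = \<lfloor>1 / r\<^sup>2\<rfloor>\<close>. Then
  \<open>1 / m \<le> 2 * r\<^sup>2\<close>, the logarithm of the number of averages is at most \<open>m * L\<close> with
  \<open>L = ln (4 * e * M * r\<^sup>2)\<close>, and \<open>lam\<close> of order \<open>sqrt L / r\<^sup>2\<close> balances the two terms. The
  assumption \<open>1 \<le> M * r\<^sup>2\<close> makes \<open>m \<le> M\<close>, so that the top entry \<open>card P + m - 1\<close> of the binomial
  coefficient is at most \<open>2 * M\<close>.
\<close>

lemma gaussian_width_convex_hull_le_sqrt_ln:
  fixes P S :: "'a::euclidean_space set"
  assumes finP: "finite P" and P: "\<And>p. p \<in> P \<Longrightarrow> norm p \<le> 1" and M: "card P \<le> M"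
    and ne: "S \<noteq> {}" and S: "S \<subseteq> convex hull P" and r: "\<And>u. u \<in> S \<Longrightarrow> norm u \<le> r"
    and r0: "0 < r" "r \<le> 1" and Mr: "1 \<le> real M * r\<^sup>2"
  shows "gaussian_width S \<le> 5 / 2 * sqrt (ln (4 * exp 1 * real M * r\<^sup>2))"
proof -
  define m where "m = nat \<lfloor>1 / r\<^sup>2\<rfloor>"
  define L where "L = ln (4 * exp 1 * real M * r\<^sup>2)"
  have r2: "0 < r\<^sup>2" "r\<^sup>2 \<le> 1"
    using r0 by (auto simp: power_le_one)
  then have inv: "1 \<le> 1 / r\<^sup>2" by simp
  then have "1 \<le> \<lfloor>1 / r\<^sup>2\<rfloor>" by (simp only: one_le_floor)
  then have m: "1 \<le> m" "real m \<le> 1 / r\<^sup>2" "1 / r\<^sup>2 < real m + 1"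
    unfolding m_def by (auto simp: le_nat_iff of_nat_nat)
  have mr: "real m * r\<^sup>2 \<le> 1"
    using m(2) r2 by (simp add: field_simps)
  have "1 < (real m + 1) * r\<^sup>2" using m(3) r2 by (simp add: field_simps)
  also have "\<dots> \<le> (2 * real m) * r\<^sup>2" using m(1) r2 by (intro mult_right_mono) auto
  finally have im: "1 / real m \<le> 2 * r\<^sup>2"
    using m(1) by (simp add: field_simps)
  have "real m \<le> real M"
  proof -
    have "1 / r\<^sup>2 \<le> real M" using Mr r2 by (simp add: field_simps)
    then show ?thesis using m(2) by linarith
  qed
  then have mM: "m \<le> M" "0 < M" using m(1) by auto
  have "P \<noteq> {}" using ne S by auto
  then have cP: "card P > 0" using finP by (simp add: card_gt_0_iff)
  have L1: "1 \<le> L"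
  proof -
    have "exp 1 * 1 \<le> exp 1 * (4 * (real M * r\<^sup>2))"
      using Mr by (intro mult_left_mono) auto
    then have "ln (exp 1) \<le> L"
      unfolding L_def using Mr r2 mM by (subst ln_le_cancel_iff) (auto simp: algebra_simps)
    then show ?thesis by simp
  qed
  define n where "n = card P + m - 1"
  have n: "m \<le> n" "n \<le> 2 * M" "0 < n"
    using cP m(1) M mM by (auto simp: n_def)
  have "ln (real (n choose m)) \<le> real m * ln (exp 1 * real n / real m)"
    using m(1) n by (intro ln_binomial_le) auto
  also have "\<dots> \<le> real m * L"
  proof (intro mult_left_mono)
    have "exp 1 * real n / real m \<le> (exp 1 * (2 * real M)) * (1 / real m)"
      using n(2) m(1) by (simp add: divide_right_mono)
    also have "\<dots> \<le> (exp 1 * (2 * real M)) * (2 * r\<^sup>2)"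
      using im by (intro mult_left_mono) auto
    finally show "ln (exp 1 * real n / real m) \<le> L"
      unfolding L_def using n m(1) r2 mM by (subst ln_le_cancel_iff) (auto simp: algebra_simps)
  qed simp
  finally have lnN: "ln (real (n choose m)) \<le> real m * L" .
  define lam where "lam = sqrt L / (2 * r\<^sup>2)"
  have lam: "lam > 0" using L1 r2 by (simp add: lam_def)
  have "gaussian_width S \<le> lam * (r\<^sup>2 + 1 / real m) + ln (real (n choose m)) / (2 * lam)"
    unfolding n_def using m(1) lam
    by (intro gaussian_width_convex_hull_le[OF finP P ne S r]) auto
  also have "\<dots> \<le> lam * (3 * r\<^sup>2) + real m * L / (2 * lam)"
    using im lam lnN by (intro add_mono mult_left_mono divide_right_mono) auto
  also have "\<dots> = 3 / 2 * sqrt L + (real m * r\<^sup>2) * sqrt L"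
  proof -
    have "L = sqrt L * sqrt L" using L1 by simp
    then have "real m * L / (2 * lam) = (real m * r\<^sup>2) * sqrt L"
      using L1 r2 by (simp add: lam_def field_simps)
    then show ?thesis using r2 by (simp add: lam_def)
  qed
  also have "\<dots> \<le> 3 / 2 * sqrt L + 1 * sqrt L"
    using mr L1 by (intro add_left_mono mult_right_mono) auto
  finally show ?thesis by (simp add: L_def)
qed

section \<open>The width of a localized convex hull\<close>

theorem proposition1:
  fixes M :: nat and p :: "nat \<Rightarrow> real ^ 'n" and T :: "(real ^ 'n) set" and s :: real
  assumes "M \<ge> 2"
    and "T = convex hull (p ` {1..M})"
    and "T \<subseteq> cball 0 1"
    and "s > 0"
    and "T \<inter> (\<lambda>u. s *\<^sub>R u) ` cball 0 1 \<noteq> {}"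
  shows "gaussian_width (T \<inter> (\<lambda>u. s *\<^sub>R u) ` cball 0 1)
      \<le> min (4 * sqrt (log_plus (4 * exp 1 * real M * min (s\<^sup>2) 1)))
             (s * sqrt (real (min CARD('n) M)))"
proof -
  define P where "P = p ` {1..M}"
  define S where "S = T \<inter> (\<lambda>u. s *\<^sub>R u) ` cball 0 1"
  \<comment> \<open>since \<open>T\<close> lies in the unit ball, intersecting with the ball of radius \<open>s\<close> or \<open>r\<close> is the same\<close>
  define r where "r = min s 1"
  define A where "A = 4 * exp 1 * real M * min (s\<^sup>2) 1"
  have T: "T = convex hull P" and ne: "S \<noteq> {}"
    using assms by (simp_all add: P_def S_def)
  have P: "finite P" "card P \<le> M" "\<And>q. q \<in> P \<Longrightarrow> norm q \<le> 1"
  proof -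
    show "finite P" by (simp add: P_def)
    show "card P \<le> M" unfolding P_def using card_image_le[of "{1..M}" p] by simp
    show "norm q \<le> 1" if "q \<in> P" for q
      using hull_subset[of P convex] that assms(3) T by auto
  qed
  have norm_s: "norm u \<le> s" if "u \<in> S" for u
    using that \<open>s > 0\<close> by (auto simp: S_def)
  have norm_r: "norm u \<le> r" if "u \<in> S" for u
    using norm_s[OF that] that assms(3) by (auto simp: S_def r_def)
  have r: "0 < r" "r \<le> 1" "r\<^sup>2 = min (s\<^sup>2) 1"
    using \<open>s > 0\<close> by (auto simp: r_def min_def power_le_one abs_square_le_1)
  have dimS: "dim S \<le> min CARD('n) M"
  proof -
    have "S \<subseteq> span P"
      using convex_hull_subset_span[of P] T by (auto simp: S_def)
    then have "dim S \<le> card P"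
      using P(1) by (rule dim_le_card)
    then show ?thesis using P(2) dim_subset_UNIV[of S] by simp
  qed
  have log1: "1 \<le> log_plus A" by (simp add: log_plus_def)
  have "gaussian_width S \<le> s * sqrt (real (dim S))"
    by (rule gaussian_width_le_sqrt_dim[OF ne norm_s])
  also have "\<dots> \<le> s * sqrt (real (min CARD('n) M))"
    using dimS \<open>s > 0\<close> by (intro mult_left_mono) auto
  finally have second: "gaussian_width S \<le> s * sqrt (real (min CARD('n) M))" .
  have "gaussian_width S \<le> 4 * sqrt (log_plus A)"
  proof (cases "1 \<le> real M * r\<^sup>2")
    case True
    have "gaussian_width S \<le> 5 / 2 * sqrt (ln A)"
      unfolding A_def r(3)[symmetric]
      by (rule gaussian_width_convex_hull_le_sqrt_ln[OF P(1,3,2) ne _ norm_r r(1,2) True])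
         (auto simp: S_def T)
    also have "\<dots> \<le> 5 / 2 * sqrt (log_plus A)"
      by (simp add: log_plus_def)
    also have "\<dots> \<le> 4 * sqrt (log_plus A)"
      using log1 by (intro mult_right_mono) auto
    finally show ?thesis .
  next
    \<comment> \<open>so small a radius that the dimension bound is already below \<open>1\<close>\<close>
    case False
    have "gaussian_width S \<le> r * sqrt (real (dim S))"
      by (rule gaussian_width_le_sqrt_dim[OF ne norm_r])
    also have "\<dots> \<le> r * sqrt (real M)"
      using dimS r by (intro mult_left_mono) auto
    also have "\<dots> = sqrt (real M * r\<^sup>2)"
      using r(1) by (simp add: real_sqrt_mult)
    also have "\<dots> \<le> 1" using False by simp
    also have "\<dots> \<le> sqrt (log_plus A)" using log1 by simp
    also have "\<dots> \<le> 4 * sqrt (log_plus A)" using log1 by simp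
    finally show ?thesis .
  qed
  with second show ?thesis by (simp add: S_def A_def)
qed

end
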